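(* Let $U\subseteq \mathbb{R}_+^n$ be a closed max cone and let $V^1,\ldots,V^n\subseteq\mathbb{R}_+^n$ be closed max cones such that the intersection of $V^i$ with $U$ is nontrivial for all $i\in\{1,\dots,n\}$. Then there exist vectors $v^1,\ldots, v^n$ such that $v^i$ is an extremal of $V^i$ for each $i\in\{1,\dots,n\}$, and $\operatorname{span}(v^1,\ldots,v^n)$ has nontrivial intersection with $U$.
   Context: A max cone is a subset of $\mathbb{R}_+^n$ closed under componentwise maximum $\oplus$ and multiplication by nonnegative scalars; closed means topologically closed. An intersection is nontrivial if it contains a nonzero vector. A vector $v\in V$ is an extremal of a max cone $V$ if $v=u\oplus w$ with $u,w\in V$ implies $v=u$ or $v=w$. $\operatorname{span}(v^1,\dots,v^n)$ is the set of all max combinations $\lambda_1v^1\oplus\cdots\oplus\lambda_nv^n$ with $\lambda_i\ge 0$. *)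

theory Defs
  imports "HOL-Analysis.Analysis"
begin

(* On real ^ 'n the order and sup of class ordered_euclidean_space are componentwise,
   so sup is the operation \<oplus> and {x. 0 \<le> x} is the nonnegative orthant. *)

definition max_cone :: "(real ^ 'n::finite) set \<Rightarrow> bool" where
  "max_cone V \<longleftrightarrow>
     V \<subseteq> {x. 0 \<le> x} \<and>
     (\<forall>u\<in>V. \<forall>w\<in>V. sup u w \<in> V) \<and>
     (\<forall>u\<in>V. \<forall>c::real. 0 \<le> c \<longrightarrow> c *\<^sub>R u \<in> V)"

(* The zero vector is not excluded. *)
definition max_extremal :: "(real ^ 'n::finite) set \<Rightarrow> real ^ 'n \<Rightarrow> bool" where
  "max_extremal V v \<longleftrightarrow>
     v \<in> V \<and> (\<forall>u\<in>V. \<forall>w\<in>V. v = sup u w \<longrightarrow> v = u \<or> v = w)"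

(* Sup_fin is the iterated sup of a finite nonempty set; repeated terms are
   harmless because sup is idempotent. *)
definition max_span :: "('i::finite \<Rightarrow> real ^ 'n::finite) \<Rightarrow> (real ^ 'n) set" where
  "max_span v =
     {Sup_fin (range (\<lambda>i. c i *\<^sub>R v i)) | c :: 'i \<Rightarrow> real. \<forall>i. 0 \<le> c i}"

definition nontrivial :: "(real ^ 'n::finite) set \<Rightarrow> bool" where
  "nontrivial S \<longleftrightarrow> (\<exists>x\<in>S. x \<noteq> 0)"

end

theory Submission
  imports Defs "HOL-Combinatorics.Cycles"
begin

text \<open>
  Pick a nonzero \<^term>\<open>u i\<close> in each \<^term>\<open>V i \<inter> U\<close>. Every max combination
  \<open>\<Oplus>\<^sub>i c\<^sub>i u\<^sub>i\<close> lies in \<^term>\<open>U\<close>, so it suffices to choose the coefficients so that this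
  very vector is also a combination of extremals \<open>v\<^sub>i\<close> of the \<^term>\<open>V i\<close>. Any coordinate of
  \<open>u\<^sub>i\<close> can be matched by an extremal of \<^term>\<open>V i\<close> below \<open>u\<^sub>i\<close>
  (\<open>extremal_below_with_coordinate\<close>), but only one coordinate at a time. Replacing \<open>u\<^sub>i\<close> by such
  a \<open>v\<^sub>i\<close> therefore preserves the combination if each of the \<open>n\<close> coordinates is attained by a
  different one of the \<open>n\<close> summands: for some permutation \<open>s\<close>, coordinate \<open>s i\<close> of the
  maximum comes from summand \<open>i\<close>.

  Such coefficients exist for every nonnegative square matrix \<open>a\<close> with rows \<open>u\<^sub>i\<close>
  (\<open>nonnegative_matrix_scaling\<close>). This is the duality for the optimal assignment problem. If all
  entries are positive, let \<open>s\<close> maximize the product of the \<open>a i (s i)\<close>. Optimality says that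
  the logarithmic weights \<open>ln (a i (s j)) - ln (a j (s j))\<close> have no cycle of positive total
  weight, hence they admit a potential, and exponentiating the potential gives the coefficients.
  Zero entries are reached by a limit: only finitely many permutations occur, and the coefficient
  vectors can be normalized to lie on a compact sphere.
\<close>

section \<open>Walks in a weighted digraph\<close>

text \<open>The list holds the intermediate vertices; both end points are separate arguments, so
  closed walks are those with equal end points and every walk has at least one edge.\<close>

fun walk_weight :: "('a \<Rightarrow> 'a \<Rightarrow> real) \<Rightarrow> 'a \<Rightarrow> 'a list \<Rightarrow> 'a \<Rightarrow> real" where
  "walk_weight w x [] y = w x y"
| "walk_weight w x (z # zs) y = w x z + walk_weight w z zs y"

lemma walk_weight_append:
  "walk_weight w x (ys @ z # zs) y = walk_weight w x ys z + walk_weight w z zs y"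
  by (induction ys arbitrary: x) auto

lemma walk_weight_eq_sum_list:
  "walk_weight w x zs y = sum_list (map2 w (x # zs) (zs @ [y]))"
  by (induction zs arbitrary: x) auto

lemma walk_weight_cycle_eq_sum:
  assumes "distinct (x # zs)"
  shows "walk_weight w x zs x = (\<Sum>i\<in>set (x # zs). w i (cycle_of_list (x # zs) i))"
proof -
  let ?c = "x # zs"
  have rot: "map (cycle_of_list ?c) ?c = zs @ [x]"
    using cyclic_rotation[OF assms, of 1] by (simp del: cycle_of_list.simps)
  have "(\<Sum>i\<in>set ?c. w i (cycle_of_list ?c i))
      = sum_list (map (\<lambda>i. w i (cycle_of_list ?c i)) ?c)"
    using sum_list_distinct_conv_sum_set[OF assms] by metis
  also have "map (\<lambda>i. w i (cycle_of_list ?c i)) ?c = map2 w ?c (map (cycle_of_list ?c) ?c)"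
    by (simp add: zip_map2 zip_same_conv_map comp_def del: cycle_of_list.simps)
  finally show ?thesis
    by (simp only: rot walk_weight_eq_sum_list)
qed

text \<open>A closed walk without repeated vertices is a cyclic permutation, and the remaining
  vertices contribute nothing because loops have weight zero. At a repeated vertex the walk splits
  into two shorter closed walks.\<close>

lemma closed_walk_nonpos:
  fixes w :: "'a::finite \<Rightarrow> 'a \<Rightarrow> real"
  assumes loop: "\<And>i. w i i = 0"
    and perm: "\<And>p. p permutes UNIV \<Longrightarrow> (\<Sum>i\<in>UNIV. w i (p i)) \<le> 0"
  shows "walk_weight w x zs x \<le> 0"
proof (induction "length zs" arbitrary: x zs rule: less_induct)
  case less
  show ?case
  proof (cases "distinct (x # zs)")
    case True
    let ?p = "cycle_of_list (x # zs)"
    have p: "?p permutes set (x # zs)" by (rule cycle_permutes)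
    have "walk_weight w x zs x = (\<Sum>i\<in>set (x # zs). w i (?p i))"
      using True by (rule walk_weight_cycle_eq_sum)
    also have "\<dots> = (\<Sum>i\<in>UNIV. w i (?p i))"
      by (rule sum.mono_neutral_left) (auto simp: loop permutes_not_in[OF p] simp del: cycle_of_list.simps)
    also have "\<dots> \<le> 0"
      by (rule perm) (rule permutes_subset[OF p], simp)
    finally show ?thesis .
  next
    case False
    then obtain ys y ms es where dec: "x # zs = ys @ [y] @ ms @ [y] @ es"
      using not_distinct_decomp by blast
    show ?thesis
    proof (cases ys)
      case Nil
      then have "zs = ms @ x # es" using dec by auto
      then show ?thesis
        using less.hyps[of ms x] less.hyps[of es x] by (simp add: walk_weight_append)
    next
      case (Cons z ys')
      then have zs: "zs = ys' @ y # ms @ y # es" and "z = x" using dec by auto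
      then show ?thesis
        using less.hyps[of ms y] less.hyps[of "ys' @ y # es" x] by (simp add: walk_weight_append)
    qed
  qed
qed

text \<open>The potential is the supremum of the weights of all walks from a fixed source. It is
  finite because every vertex has an edge back to the source, which closes the walk.\<close>

lemma potential_exists:
  fixes w :: "'a \<Rightarrow> 'a \<Rightarrow> real"
  assumes closed: "\<And>x zs. walk_weight w x zs x \<le> 0"
  obtains p where "\<And>i j. p i + w i j \<le> p j"
proof -
  fix source :: 'a
  define p where "p j = (SUP zs. walk_weight w source zs j)" for j
  have bdd: "bdd_above (range (\<lambda>zs. walk_weight w source zs j))" for j
  proof (rule bdd_aboveI2)
    show "walk_weight w source zs j \<le> - w j source" for zs
      using closed[of source "zs @ [j]"] by (simp add: walk_weight_append)
  qed
  have "p i + w i j \<le> p j" for i j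
  proof -
    have "walk_weight w source zs i \<le> p j - w i j" for zs
      using cSUP_upper[OF _ bdd, of "zs @ [i]" j] by (simp add: walk_weight_append p_def)
    then have "p i \<le> p j - w i j"
      unfolding p_def[of i] by (intro cSUP_least) auto
    then show ?thesis by simp
  qed
  then show thesis by (rule that)
qed

section \<open>Scalings that place column maxima on a permutation\<close>

text \<open>Composing an optimal assignment \<^term>\<open>s\<close> with a permutation \<^term>\<open>p\<close> cannot increase its
  value, which is the condition that \<open>closed_walk_nonpos\<close> asks of the weights \<open>w\<close>.\<close>

lemma positive_matrix_scaling:
  fixes a :: "'n::finite \<Rightarrow> 'n \<Rightarrow> real"
  assumes pos: "\<And>i j. 0 < a i j"
  obtains c s where "\<And>i. 0 < c i" "s permutes UNIV"
    "\<And>i k. c k * a k (s i) \<le> c i * a i (s i)"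
proof -
  define f where "f p = (\<Sum>i\<in>UNIV. ln (a i (p i)))" for p
  let ?P = "{p :: 'n \<Rightarrow> 'n. p permutes UNIV}"
  have fin: "finite (f ` ?P)" by simp
  have ne: "f ` ?P \<noteq> {}" using permutes_id by blast
  obtain s where s: "s permutes UNIV" and "f s = Max (f ` ?P)"
    using Max_in[OF fin ne] by auto
  then have max: "f p \<le> f s" if "p permutes UNIV" for p
    using Max_ge[OF fin, of "f p"] that by auto
  define w where "w i j = ln (a i (s j)) - ln (a j (s j))" for i j
  have perm: "(\<Sum>i\<in>UNIV. w i (p i)) \<le> 0" if p: "p permutes UNIV" for p
  proof -
    have "(\<Sum>i\<in>UNIV. ln (a (p i) (s (p i)))) = f s"
      unfolding f_def by (rule sum.permute[OF p, symmetric, unfolded comp_def])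
    moreover have "(\<Sum>i\<in>UNIV. ln (a i (s (p i)))) = f (s \<circ> p)"
      by (simp add: f_def)
    ultimately show ?thesis
      using max[OF permutes_compose[OF p s]] by (simp add: w_def sum_subtractf)
  qed
  obtain q where q: "\<And>i j. q i + w i j \<le> q j"
  proof (rule potential_exists)
    show "walk_weight w x zs x \<le> 0" for x zs
      by (rule closed_walk_nonpos[OF _ perm]) (simp add: w_def)
  qed (rule that)
  have "exp (q k) * a k (s i) \<le> exp (q i) * a i (s i)" for i k
  proof -
    have "exp (q k + ln (a k (s i))) \<le> exp (q i + ln (a i (s i)))"
      using q[of k i] by (simp add: w_def)
    then show ?thesis by (simp add: exp_add pos)
  qed
  with s show thesis by (intro that[of "\<lambda>i. exp (q i)" s]) auto
qed

text \<open>Coefficients for the positive matrices \<open>a + 1 / (m + 1)\<close> are scaled to norm 1, so that the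
  limit of a convergent subsequence is nonzero. Some permutation is used infinitely often, and the
  inequalities for it pass to the limit. Positivity of all coefficients can be lost:
  the rows \<open>(1, 1, 1)\<close>, \<open>(1, 0, 0)\<close>, \<open>(1, 0, 0)\<close> force the coefficient of the first row to
  be zero.\<close>

lemma nonnegative_matrix_scaling:
  fixes a :: "'n::finite \<Rightarrow> 'n \<Rightarrow> real"
  assumes nonneg: "\<And>i j. 0 \<le> a i j"
  obtains c :: "real ^ 'n" and s where "0 \<le> c" "c \<noteq> 0" "s permutes UNIV"
    "\<And>i k. c $ k * a k (s i) \<le> c $ i * a i (s i)"
proof -
  define e where "e m = inverse (real (Suc m))" for m
  have e0: "e \<longlonglongrightarrow> 0" unfolding e_def by (rule LIMSEQ_inverse_real_of_nat)
  have "\<exists>c :: real ^ 'n. \<exists>s. 0 \<le> c \<and> norm c = 1 \<and> s permutes UNIV \<and>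
      (\<forall>i k. c $ k * (a k (s i) + e m) \<le> c $ i * (a i (s i) + e m))" for m
  proof -
    have "0 < a i j + e m" for i j
      using nonneg[of i j] by (simp add: e_def add_nonneg_pos)
    then obtain c s where c: "\<And>i. 0 < c i" and s: "s permutes UNIV"
      and le: "\<And>i k. c k * (a k (s i) + e m) \<le> c i * (a i (s i) + e m)"
      using positive_matrix_scaling[of "\<lambda>i j. a i j + e m"] by metis
    define d where "d = (\<chi> i. c i)"
    have "d \<noteq> 0" using c by (auto simp: d_def vec_eq_iff less_le)
    then have "0 < inverse (norm d)" by simp
    then show ?thesis
      using c le s \<open>d \<noteq> 0\<close>
      by (intro exI[of _ "inverse (norm d) *\<^sub>R d"] exI[of _ s])
         (auto simp: d_def less_eq_vec_def mult.assoc intro!: mult_left_mono less_imp_le)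
  qed
  then obtain c :: "nat \<Rightarrow> real ^ 'n" and s where
    c: "\<And>m. 0 \<le> c m" "\<And>m. norm (c m) = 1" and s: "\<And>m. s m permutes UNIV"
    and le: "\<And>m i k. c m $ k * (a k (s m i) + e m) \<le> c m $ i * (a i (s m i) + e m)"
    by metis
  have "finite (range s)" by (rule finite_subset[of _ "{p. p permutes UNIV}"]) (auto simp: s)
  then obtain m0 where "infinite {m. s m = s m0}"
    using pigeonhole_infinite[of UNIV s] by auto
  then obtain r :: "nat \<Rightarrow> nat" where r: "strict_mono r" "\<And>m. s (r m) = s m0"
    using infinite_enumerate by blast
  have "compact (sphere (0 :: real ^ 'n) 1)" by (rule compact_sphere)
  then obtain l q where l: "l \<in> sphere 0 1" and q: "strict_mono q" "(c \<circ> r \<circ> q) \<longlonglongrightarrow> l"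
    unfolding compact_def using c(2) by (metis comp_apply mem_sphere_0)
  have lim: "(\<lambda>m. c (r (q m)) $ i) \<longlonglongrightarrow> l $ i" for i
    using tendsto_vec_nth[OF q(2)] by (simp add: comp_def)
  have elim: "(\<lambda>m. e (r (q m))) \<longlonglongrightarrow> 0"
    using LIMSEQ_subseq_LIMSEQ[OF e0 strict_mono_o[OF r(1) q(1)]] by (simp add: comp_def)
  have "l $ k * (a k (s m0 i) + 0) \<le> l $ i * (a i (s m0 i) + 0)" for i k
    by (rule LIMSEQ_le[OF tendsto_mult[OF lim tendsto_add[OF tendsto_const elim]]
          tendsto_mult[OF lim tendsto_add[OF tendsto_const elim]]])
       (metis le r(2))
  moreover have "0 \<le> l"
    unfolding less_eq_vec_def using c(1)
    by (auto intro!: LIMSEQ_le_const[OF lim] simp: less_eq_vec_def)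
  moreover have "l \<noteq> 0" using l by auto
  ultimately show thesis using s[of m0] by (intro that[of l "s m0"]) auto
qed

section \<open>Extremals below a point of a closed max cone\<close>

text \<open>A point with least coordinate sum among the points of \<^term>\<open>V\<close> below \<^term>\<open>u\<close> that share
  coordinate \<^term>\<open>j\<close> with it is extremal: if it is the maximum of two points of \<^term>\<open>V\<close>, one of
  them attains coordinate \<^term>\<open>j\<close>, hence competes in the minimization and cannot be smaller.\<close>

lemma extremal_below_with_coordinate:
  fixes V :: "(real ^ 'n::finite) set"
  assumes V: "max_cone V" "closed V" and u: "u \<in> V"
  obtains v where "max_extremal V v" "v \<le> u" "v $ j = u $ j"
proof -
  define K where "K = V \<inter> {0..u} \<inter> {x. x $ j = u $ j}"
  define f where "f x = (\<Sum>i\<in>UNIV. x $ i)" for x :: "real ^ 'n"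
  have nonneg: "0 \<le> x" if "x \<in> V" for x
    using V(1) that by (auto simp: max_cone_def)
  have "closed {x :: real ^ 'n. x $ j = u $ j}"
    by (intro closed_Collect_eq continuous_intros)
  then have "compact K"
    unfolding K_def using V(2) by (intro compact_Int_closed closed_Int_compact compact_interval) auto
  moreover have "K \<noteq> {}" using u nonneg by (auto simp: K_def)
  moreover have "continuous_on K f" unfolding f_def by (intro continuous_intros)
  ultimately have "\<exists>v\<in>K. \<forall>x\<in>K. f v \<le> f x" by (rule continuous_attains_inf)
  then obtain v where v: "v \<in> K" and min: "\<And>x. x \<in> K \<Longrightarrow> f v \<le> f x" by blast
  have eq: "x = v" if x: "x \<in> V" "x \<le> v" "x $ j = v $ j" for x
  proof -
    have "x \<in> K" using x v nonneg[of x] by (auto simp: K_def)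
    then have "f v \<le> f x" by (rule min)
    then have "(\<Sum>i\<in>UNIV. v $ i - x $ i) \<le> 0" by (simp add: f_def sum_subtractf)
    moreover have nn: "0 \<le> v $ i - x $ i" for i using x(2) by (simp add: less_eq_vec_def)
    ultimately have "(\<Sum>i\<in>UNIV. v $ i - x $ i) = 0" by (intro antisym sum_nonneg) auto
    then have "\<forall>i. v $ i - x $ i = 0" using nn by (subst (asm) sum_nonneg_eq_0_iff) auto
    then show ?thesis by (simp add: vec_eq_iff)
  qed
  have "v = x \<or> v = y" if "x \<in> V" "y \<in> V" "v = sup x y" for x y
  proof -
    have "v $ j = max (x $ j) (y $ j)" using that(3) by (simp add: sup_vec_def sup_max)
    then have "x $ j = v $ j \<or> y $ j = v $ j" by (auto simp: max_def)
    moreover have "x \<le> v" "y \<le> v" unfolding that(3) by simp_all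
    ultimately show ?thesis using eq that(1,2) by metis
  qed
  then have "max_extremal V v" using v by (auto simp: max_extremal_def K_def)
  then show thesis using v by (intro that[of v]) (auto simp: K_def)
qed

section \<open>The colourful Caratheodory theorem for max cones\<close>

lemma max_cone_Sup_fin:
  assumes "max_cone U" "finite A" "A \<noteq> {}" "A \<subseteq> U"
  shows "Sup_fin A \<in> U"
  using assms(2-4,1) by (induction A rule: finite_ne_induct) (auto simp: max_cone_def)

theorem theorem3p22:
  fixes U :: "(real ^ 'n::finite) set"
    and V :: "'n \<Rightarrow> (real ^ 'n) set"
  assumes "max_cone U" and "closed U"
    and "\<And>i. max_cone (V i)" and "\<And>i. closed (V i)"
    and "\<And>i. nontrivial (V i \<inter> U)"
  shows "\<exists>v :: 'n \<Rightarrow> real ^ 'n.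
           (\<forall>i. max_extremal (V i) (v i)) \<and> nontrivial (max_span v \<inter> U)"
proof -
  obtain u where u: "\<And>i. u i \<in> V i" "\<And>i. u i \<in> U" "\<And>i. u i \<noteq> 0"
    using assms(5) unfolding nontrivial_def by (metis Int_iff)
  have u_nonneg: "0 \<le> u i" for i using u(2) assms(1) by (auto simp: max_cone_def)
  then have "0 \<le> u i $ j" for i j by (simp add: less_eq_vec_def)
  then obtain c :: "real ^ 'n" and s where c: "0 \<le> c" "c \<noteq> 0" and s: "s permutes UNIV"
    and dom: "\<And>i k. c $ k * u k $ (s i) \<le> c $ i * u i $ (s i)"
    using nonnegative_matrix_scaling[of "\<lambda>i j. u i $ j"] by metis
  have c_nonneg: "0 \<le> c $ i" for i using c(1) by (simp add: less_eq_vec_def)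
  have "\<exists>v. max_extremal (V i) v \<and> v \<le> u i \<and> v $ s i = u i $ s i" for i
    using extremal_below_with_coordinate[OF assms(3,4) u(1)] by metis
  then obtain v where v: "\<And>i. max_extremal (V i) (v i)" "\<And>i. v i \<le> u i"
    "\<And>i. v i $ s i = u i $ s i"
    by metis
  define x where "x = Sup_fin (range (\<lambda>i. c $ i *\<^sub>R u i))"
  define y where "y = Sup_fin (range (\<lambda>i. c $ i *\<^sub>R v i))"
  have x_ge: "c $ i *\<^sub>R u i \<le> x" for i unfolding x_def by (rule Sup_fin.coboundedI) auto
  have y_ge: "c $ i *\<^sub>R v i \<le> y" for i unfolding y_def by (rule Sup_fin.coboundedI) auto
  have "y \<le> x"
    unfolding y_def
    by (rule Sup_fin.boundedI)
       (auto intro: order_trans[OF scaleR_left_mono[OF v(2) c_nonneg] x_ge])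
  \<comment> \<open>Coordinate \<^term>\<open>s i\<close> of every summand is dominated by summand \<^term>\<open>i\<close>, where passing
    from \<^term>\<open>u i\<close> to \<^term>\<open>v i\<close> changes nothing.\<close>
  moreover have "c $ k *\<^sub>R u k \<le> y" for k
    unfolding less_eq_vec_def
  proof
    fix j
    obtain i where j: "j = s i" using permutes_surj[OF s] by (metis surjD)
    have "c $ k * u k $ j \<le> c $ i * v i $ j" unfolding j v(3) by (rule dom)
    also have "\<dots> \<le> y $ j" using y_ge[of i] by (simp add: less_eq_vec_def)
    finally show "(c $ k *\<^sub>R u k) $ j \<le> y $ j" by simp
  qed
  then have "x \<le> y" unfolding x_def by (intro Sup_fin.boundedI) auto
  ultimately have "y = x" by simp
  have "x \<in> U"
    unfolding x_def using assms(1) u(2) c_nonneg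
    by (intro max_cone_Sup_fin) (auto simp: max_cone_def)
  moreover have "y \<in> max_span v" unfolding max_span_def y_def using c_nonneg by blast
  moreover have "x \<noteq> 0"
  proof
    assume "x = 0"
    obtain i where "c $ i \<noteq> 0" using c(2) by (auto simp: vec_eq_iff)
    moreover have "c $ i *\<^sub>R u i = 0"
    proof (rule antisym)
      show "c $ i *\<^sub>R u i \<le> 0" using x_ge[of i] \<open>x = 0\<close> by simp
      show "0 \<le> c $ i *\<^sub>R u i" by (rule scaleR_nonneg_nonneg[OF c_nonneg u_nonneg])
    qed
    ultimately show False using u(3) by simp
  qed
  ultimately have "nontrivial (max_span v \<inter> U)"
    unfolding nontrivial_def \<open>y = x\<close> by blast
  with v(1) show ?thesis by blast
qed

end
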